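(* Let $n\ge 2$ and let $E(\mathcal{A})$ be the exchange module of the type-$A_n$ cluster algebra. Then $E(\mathcal{A})$ is a free $\mathbb{Z}$-module, generated by the set $\{x_\alpha-x_\beta:\ \alpha,\beta \text{ crossing diagonals of } P_{n+3},\ \alpha \text{ has the vertex } 1 \text{ as an endpoint}\}$. Moreover, this generating set has size $\binom{n+2}{3}$.
   Context: Let $P_{n+3}$ be a convex $(n+3)$-gon with vertices labeled $1,\dots,n+3$ clockwise. The type-$A_n$ cluster algebra $\mathcal{A}$: fix a triangulation $T$ of $P_{n+3}$, assign independent indeterminates to its $n$ diagonals and to the $n+3$ sides (the side variables are frozen), in the field $\mathbb{Q}(x_1,\dots,x_{2n+3})$. Each diagonal flip, replacing a diagonal $k$ by the other diagonal $k'$ of the quadrilateral with sides $a,b,c,d$ (in cyclic order) containing it, defines $x_{k'}$ by $x_kx_{k'}=x_ax_c+x_bx_d$; this yields a well-defined cluster variable $x_\gamma\in\mathbb{Q}(x_1,\dots,x_{2n+3})$ for every diagonal $\gamma$. The exchange module $E(\mathcal{A})$ is the $\mathbb{Z}$-submodule of $\mathbb{Q}(x_1,\dots,x_{2n+3})$ generated by all differences $x_\alpha-x_\beta$ with $\alpha,\beta$ crossing diagonals of $P_{n+3}$. *)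

theory Defs
  imports
    Complex_Main
    "HOL-Library.Poly_Mapping"
    "HOL-Computational_Algebra.Fraction_Field"
begin

section \<open>Diagonals and triangulations of a convex polygon\<close>

text \<open>
  The vertices of the polygon are \<open>1, \<dots>, n + 3\<close> in cyclic order; a side or diagonal is the
  two-element set of its endpoints.
\<close>

definition sides :: "nat \<Rightarrow> nat set set" where
  "sides n = {{i, i + 1} | i. i \<in> {1..n + 2}} \<union> {{n + 3, 1}}"

definition diagonals :: "nat \<Rightarrow> nat set set" where
  "diagonals n = {{i, j} | i j. i \<in> {1..n + 3} \<and> j \<in> {1..n + 3} \<and> i \<noteq> j} - sides n"

text \<open>
  In a convex polygon two segments between vertices meet in their interiors iff their
  endpoints are four distinct, interleaved vertices.
\<close>

definition crosses :: "nat set \<Rightarrow> nat set \<Rightarrow> bool" where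
  "crosses \<alpha> \<beta> \<longleftrightarrow>
     (\<exists>a b c d. a < b \<and> b < c \<and> c < d \<and>
        (\<alpha> = {a, c} \<and> \<beta> = {b, d} \<or> \<alpha> = {b, d} \<and> \<beta> = {a, c}))"

definition triangulation :: "nat \<Rightarrow> nat set set \<Rightarrow> bool" where
  "triangulation n T \<longleftrightarrow>
     T \<subseteq> diagonals n \<and>
     (\<forall>\<alpha>\<in>T. \<forall>\<beta>\<in>T. \<not> crosses \<alpha> \<beta>) \<and>
     (\<forall>\<gamma>\<in>diagonals n - T. \<exists>\<delta>\<in>T. crosses \<gamma> \<delta>)"


section \<open>Cluster variables\<close>

text \<open>
  The field of rational functions over the rationals in indeterminates indexed by \<open>'v\<close>, as the
  fraction field of the polynomial ring; a monomial is its exponent function \<open>'v \<Rightarrow>\<^sub>0 nat\<close>.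
  The order on \<open>'v\<close> plays no mathematical role: the library's integral domain instance for
  \<open>\<Rightarrow>\<^sub>0\<close> needs it.
\<close>

type_synonym 'v ratfun = "(('v \<Rightarrow>\<^sub>0 nat) \<Rightarrow>\<^sub>0 rat) fract"

definition indet :: "'v::linorder \<Rightarrow> 'v ratfun" where
  "indet v = Fract (Poly_Mapping.single (Poly_Mapping.single v 1) 1) 1"

text \<open>
  \<open>seed n T \<l> S x\<close>: the triangulation \<open>S\<close> together with the elements \<open>x e\<close> attached to
  \<open>e \<in> S \<union> sides n\<close> is obtained by finitely many flips from \<open>T\<close> with the indeterminates
  \<open>indet (\<l> e)\<close>, \<open>e \<in> T \<union> sides n\<close>. Values of \<open>x\<close> outside \<open>S \<union> sides n\<close> are irrelevant.
  In a flip, \<open>crosses {p, r} {q, s}\<close> says that \<open>p, q, r, s\<close> are in cyclic order (in one of the two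
  directions), so that \<open>{p, q}\<close>, \<open>{r, s}\<close> and \<open>{q, r}\<close>, \<open>{s, p}\<close> are the pairs of opposite sides
  of the quadrilateral.
\<close>

inductive seed ::
  "nat \<Rightarrow> nat set set \<Rightarrow> (nat set \<Rightarrow> 'v::linorder) \<Rightarrow> nat set set \<Rightarrow> (nat set \<Rightarrow> 'v ratfun) \<Rightarrow> bool"
  for n T \<l> where
  initial: "seed n T \<l> T (\<lambda>e. indet (\<l> e))"
| flip: "seed n T \<l> (insert {q, s} (S - {{p, r}}))
           (x({q, s} := (x {p, q} * x {r, s} + x {q, r} * x {s, p}) / x {p, r}))"
  if "seed n T \<l> S x"
    and "{p, r} \<in> S"
    and "crosses {p, r} {q, s}"
    and "{p, q} \<in> S \<union> sides n" and "{q, r} \<in> S \<union> sides n"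
    and "{r, s} \<in> S \<union> sides n" and "{s, p} \<in> S \<union> sides n"

definition cluster_var ::
  "nat \<Rightarrow> nat set set \<Rightarrow> (nat set \<Rightarrow> 'v::linorder) \<Rightarrow> nat set \<Rightarrow> 'v ratfun" where
  "cluster_var n T \<l> \<gamma> = (THE f. \<exists>S x. seed n T \<l> S x \<and> \<gamma> \<in> S \<and> x \<gamma> = f)"


section \<open>The exchange module\<close>

interpretation int_module: module "\<lambda>(k::int) (x::'a::comm_ring_1). of_int k * x"
  by unfold_locales (simp_all add: algebra_simps)

definition exchange_module ::
  "nat \<Rightarrow> nat set set \<Rightarrow> (nat set \<Rightarrow> 'v::linorder) \<Rightarrow> 'v ratfun set" where
  "exchange_module n T \<l> =
     int_module.span {cluster_var n T \<l> \<alpha> - cluster_var n T \<l> \<beta> | \<alpha> \<beta>.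
       \<alpha> \<in> diagonals n \<and> \<beta> \<in> diagonals n \<and> crosses \<alpha> \<beta>}"

definition exchange_generators ::
  "nat \<Rightarrow> nat set set \<Rightarrow> (nat set \<Rightarrow> 'v::linorder) \<Rightarrow> 'v ratfun set" where
  "exchange_generators n T \<l> =
     {cluster_var n T \<l> \<alpha> - cluster_var n T \<l> \<beta> | \<alpha> \<beta>.
       \<alpha> \<in> diagonals n \<and> \<beta> \<in> diagonals n \<and> crosses \<alpha> \<beta> \<and> 1 \<in> \<alpha>}"

definition free_int_module :: "'a::comm_ring_1 set \<Rightarrow> bool" where
  "free_int_module M \<longleftrightarrow> (\<exists>B. int_module.independent B \<and> int_module.span B = M)"

end

theory Submission
  imports Defs
begin

text \<open>
  Cutting the polygon into the triangles of \<open>T\<close>, one finds vectors \<open>v\<^sub>i\<close> in the plane over the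
  field of rational functions with \<open>det (v\<^sub>i, v\<^sub>j)\<close> equal to the indeterminate of \<open>{i, j}\<close> for every
  edge \<open>{i, j}\<close> of \<open>T\<close> and every side. The Pluecker relations are the exchange relations, so
  every flip sequence produces these minors; and every diagonal is reached, by first flipping to
  the fan at vertex 1. Hence cluster variables are well defined.

  Evaluating the indeterminates so that \<open>x\<^sub>i\<^sub>j\<close> takes the value \<open>s\<^sub>i s\<^sub>j (j - i)\<close> shows that the cluster
  variables are linearly independent. Since all \<open>{1, k}\<close> cross \<open>{2, n + 3}\<close> and every
  other diagonal crosses some \<open>{1, k}\<close>, the generators at vertex 1 span all differences of cluster
  variables, a module with basis \<open>x\<^sub>\<gamma> - x\<^sub>\<delta>\<close> for \<open>\<delta> = {2, n + 3}\<close> and \<open>\<gamma> \<noteq> \<delta>\<close>.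
\<close>

subsection \<open>Evaluation of rational functions\<close>

definition monom_eval :: "('v \<Rightarrow> 'a::comm_semiring_1) \<Rightarrow> ('v \<Rightarrow>\<^sub>0 nat) \<Rightarrow> 'a" where
  "monom_eval w m = (\<Prod>v\<in>Poly_Mapping.keys m. w v ^ Poly_Mapping.lookup m v)"

definition poly_eval :: "('v \<Rightarrow> 'a::comm_semiring_1) \<Rightarrow> (('v \<Rightarrow>\<^sub>0 nat) \<Rightarrow>\<^sub>0 'a) \<Rightarrow> 'a" where
  "poly_eval w p = (\<Sum>m\<in>Poly_Mapping.keys p. Poly_Mapping.lookup p m * monom_eval w m)"

text \<open>Exponents outside the support are 0 and contribute the factor 1. Enlarging the index set
  lets products over different supports be compared.\<close>

lemma monom_eval_superset:
  assumes "finite V" "Poly_Mapping.keys m \<subseteq> V"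
  shows "monom_eval w m = (\<Prod>v\<in>V. w v ^ Poly_Mapping.lookup m v)"
  unfolding monom_eval_def using assms
  by (intro prod.mono_neutral_left) (auto simp: in_keys_iff)

lemma poly_eval_superset:
  assumes "finite M" "Poly_Mapping.keys p \<subseteq> M"
  shows "poly_eval w p = (\<Sum>m\<in>M. Poly_Mapping.lookup p m * monom_eval w m)"
  unfolding poly_eval_def using assms
  by (intro sum.mono_neutral_left) (auto simp: in_keys_iff)

lemma monom_eval_add: "monom_eval w (m + m') = monom_eval w m * monom_eval w m'"
proof -
  let ?V = "Poly_Mapping.keys m \<union> Poly_Mapping.keys m'"
  have "Poly_Mapping.keys (m + m') \<subseteq> ?V"
    by (rule Poly_Mapping.keys_add)
  then show ?thesis
    by (simp add: monom_eval_superset[of ?V] lookup_add power_add prod.distrib)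
qed

lemma poly_eval_0 [simp]: "poly_eval w 0 = 0"
  by (simp add: poly_eval_def)

lemma poly_eval_add: "poly_eval w (p + q) = poly_eval w p + poly_eval w q"
proof -
  let ?M = "Poly_Mapping.keys p \<union> Poly_Mapping.keys q"
  have "Poly_Mapping.keys (p + q) \<subseteq> ?M"
    by (rule Poly_Mapping.keys_add)
  then show ?thesis
    by (simp add: poly_eval_superset[of ?M] lookup_add distrib_right sum.distrib)
qed

lemma poly_eval_single: "poly_eval w (Poly_Mapping.single m c) = c * monom_eval w m"
  by (cases "c = 0") (simp_all add: poly_eval_def)

lemma poly_eval_1 [simp]: "poly_eval w 1 = 1"
  by (simp add: poly_eval_single monom_eval_def flip: single_one)

lemma poly_eval_uminus:
  fixes w :: "'v \<Rightarrow> 'a::comm_ring_1"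
  shows "poly_eval w (- p) = - poly_eval w p"
  using poly_eval_add[of w p "- p"] by (simp add: minus_unique)

lemma poly_eval_mult_single:
  "poly_eval w (Poly_Mapping.single m c * q) = c * monom_eval w m * poly_eval w q"
proof (induction q rule: update_induct)
  case const
  show ?case by simp
next
  case (update q m' c')
  \<comment> \<open>The induction adds a monomial absent from \<open>q\<close>, so the update is a
    sum.\<close>
  have "Poly_Mapping.update m' c' q = q + Poly_Mapping.single m' c'"
    using update by (intro poly_mapping_eqI) (auto simp: lookup_update lookup_add lookup_single in_keys_iff)
  then show ?case
    using update
    by (simp add: distrib_left poly_eval_add poly_eval_single mult_single monom_eval_add ac_simps)
qed

lemma poly_eval_mult: "poly_eval w (p * q) = poly_eval w p * poly_eval w q"
proof (induction p rule: update_induct)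
  case const
  show ?case by simp
next
  case (update p m c)
  have "Poly_Mapping.update m c p = p + Poly_Mapping.single m c"
    using update by (intro poly_mapping_eqI) (auto simp: lookup_update lookup_add lookup_single in_keys_iff)
  then show ?case
    using update
    by (simp add: distrib_right poly_eval_add poly_eval_single poly_eval_mult_single)
qed

text \<open>A relation, since a rational function may have no value at \<open>w\<close>: some
  representing fraction must have a denominator that does not vanish there.\<close>

definition evaluates :: "('v::linorder \<Rightarrow> rat) \<Rightarrow> 'v ratfun \<Rightarrow> rat \<Rightarrow> bool" where
  "evaluates w f r \<longleftrightarrow>
     (\<exists>p q. f = Fract p q \<and> poly_eval w q \<noteq> 0 \<and> r = poly_eval w p / poly_eval w q)"

lemma evaluatesI:
  "f = Fract p q \<Longrightarrow> poly_eval w q \<noteq> 0 \<Longrightarrow> r = poly_eval w p / poly_eval w q \<Longrightarrow> evaluates w f r"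
  unfolding evaluates_def by blast

lemma evaluatesE:
  assumes "evaluates w f r"
  obtains p q where "f = Fract p q" "q \<noteq> 0" "poly_eval w q \<noteq> 0" "r = poly_eval w p / poly_eval w q"
  using assms unfolding evaluates_def by (metis poly_eval_0)

text \<open>A fraction equal to 0 has numerator 0. Hence a nonzero value certifies a nonzero
  rational function, and a linear relation between rational functions passes to their
  values.\<close>

lemma evaluates_zero_iff [simp]: "evaluates w 0 r \<longleftrightarrow> r = 0"
proof
  assume "evaluates w 0 r"
  then obtain p q where "0 = Fract p q" "q \<noteq> 0" "r = poly_eval w p / poly_eval w q"
    by (rule evaluatesE)
  then have "p = 0"
    by (metis eq_fract(1) Zero_fract_def mult_eq_0_iff one_neq_zero)
  then show "r = 0"
    using \<open>r = _\<close> by simp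
next
  assume "r = 0"
  then show "evaluates w 0 r"
    by (intro evaluatesI[of _ 0 1]) (simp_all add: Zero_fract_def)
qed

lemma evaluates_1: "evaluates w 1 1"
  by (rule evaluatesI[of _ 1 1]) (simp_all add: One_fract_def)

lemma evaluates_indet: "evaluates w (indet v) (w v)"
  unfolding indet_def
  by (rule evaluatesI[OF refl]) (simp_all add: poly_eval_single monom_eval_def)

lemma evaluates_add:
  assumes "evaluates w f r" "evaluates w g s"
  shows "evaluates w (f + g) (r + s)"
  using assms
  by (elim evaluatesE, hypsubst)
    (rule evaluatesI[OF add_fract], auto simp: poly_eval_add poly_eval_mult field_simps)

lemma evaluates_uminus:
  assumes "evaluates w f r"
  shows "evaluates w (- f) (- r)"
  using assms
  by (elim evaluatesE, hypsubst) (rule evaluatesI[OF minus_fract], auto simp: poly_eval_uminus)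

lemma evaluates_mult:
  assumes "evaluates w f r" "evaluates w g s"
  shows "evaluates w (f * g) (r * s)"
  using assms
  by (elim evaluatesE, hypsubst) (rule evaluatesI[OF mult_fract], auto simp: poly_eval_mult)

lemma evaluates_divide:
  assumes "evaluates w f r" "evaluates w g s" "s \<noteq> 0"
  shows "evaluates w (f / g) (r / s)"
  using assms
  by (elim evaluatesE, hypsubst) (rule evaluatesI[OF divide_fract], auto simp: poly_eval_mult)

lemma evaluates_of_int: "evaluates w (of_int k) (of_int k)"
proof (induction k rule: int_induct[of _ 0])
  case (step1 k)
  then show ?case using evaluates_add[OF _ evaluates_1] by fastforce
next
  case (step2 k)
  then show ?case using evaluates_add[OF _ evaluates_uminus[OF evaluates_1]] by fastforce
qed simp

lemma evaluates_sum:
  assumes "\<And>i. i \<in> A \<Longrightarrow> evaluates w (f i) (r i)"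
  shows "evaluates w (\<Sum>i\<in>A. f i) (\<Sum>i\<in>A. r i)"
  using assms by (induction A rule: infinite_finite_induct) (auto intro: evaluates_add)


subsection \<open>Triangulations\<close>

lemma crosses_iff:
  assumes "i < j" "k < l"
  shows "crosses {i, j} {k, l} \<longleftrightarrow> i < k \<and> k < j \<and> j < l \<or> k < i \<and> i < l \<and> l < j"
proof
  assume "crosses {i, j} {k, l}"
  then show "i < k \<and> k < j \<and> j < l \<or> k < i \<and> i < l \<and> l < j"
    unfolding crosses_def using assms by (auto simp: doubleton_eq_iff)
qed (use assms in \<open>auto simp: crosses_def\<close>)

lemma sides_iff:
  assumes "i < j"
  shows "{i, j} \<in> sides n \<longleftrightarrow> 1 \<le> i \<and> j \<le> n + 3 \<and> (j = i + 1 \<or> i = 1 \<and> j = n + 3)"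
  using assms unfolding sides_def by (auto simp: doubleton_eq_iff)

lemma diagonals_iff:
  assumes "i < j"
  shows "{i, j} \<in> diagonals n \<longleftrightarrow> 1 \<le> i \<and> j \<le> n + 3 \<and> i + 2 \<le> j \<and> \<not> (i = 1 \<and> j = n + 3)"
proof -
  have "{i, j} \<in> diagonals n \<longleftrightarrow> 1 \<le> i \<and> j \<le> n + 3 \<and> {i, j} \<notin> sides n"
  proof
    assume "1 \<le> i \<and> j \<le> n + 3 \<and> {i, j} \<notin> sides n"
    then show "{i, j} \<in> diagonals n"
      using assms unfolding diagonals_def by (intro DiffI CollectI exI[of _ i] exI[of _ j]) auto
  qed (use assms in \<open>auto simp: diagonals_def doubleton_eq_iff\<close>)
  then show ?thesis
    using assms by (auto simp: sides_iff)
qed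

lemma edgeE:
  assumes "e \<in> diagonals n \<union> sides n"
  obtains i j where "e = {i, j}" "1 \<le> i" "i < j" "j \<le> n + 3"
proof -
  have "\<exists>i j. e = {i, j} \<and> i \<in> {1..n + 3} \<and> j \<in> {1..n + 3} \<and> i \<noteq> j"
    using assms
  proof
    assume "e \<in> sides n"
    then consider i where "e = {i, i + 1}" "i \<in> {1..n + 2}" | "e = {n + 3, 1}"
      unfolding sides_def by blast
    then show ?thesis
    proof cases
      case 1
      then show ?thesis by (intro exI[of _ i] exI[of _ "i + 1"]) auto
    next
      case 2
      then show ?thesis by (intro exI[of _ "n + 3"] exI[of _ 1]) auto
    qed
  qed (auto simp: diagonals_def)
  then obtain i j where "e = {i, j}" "i \<in> {1..n + 3}" "j \<in> {1..n + 3}" "i \<noteq> j"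
    by blast
  then show ?thesis
    using that[of i j] that[of j i] by (cases "i < j") (auto simp: insert_commute)
qed

lemma diagonalE:
  assumes "e \<in> diagonals n"
  obtains i j where "e = {i, j}" "1 \<le> i" "i + 2 \<le> j" "j \<le> n + 3" "\<not> (i = 1 \<and> j = n + 3)"
proof -
  obtain i j where "e = {i, j}" "i < j"
    using assms edgeE by blast
  then show ?thesis
    using that assms by (auto simp: diagonals_iff)
qed

lemma finite_diagonals: "finite (diagonals n)"
proof (rule finite_subset)
  show "diagonals n \<subseteq> Pow {1..n + 3}" by (auto simp: diagonals_def)
qed simp

lemma crosses_sym: "crosses \<alpha> \<beta> \<Longrightarrow> crosses \<beta> \<alpha>"
  unfolding crosses_def by blast

text \<open>A crossing needs a vertex strictly inside each of the two arcs between the endpoints;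
  for a side one arc has none.\<close>

lemma not_crosses_side:
  assumes "\<alpha> \<in> sides n" "\<beta> \<in> diagonals n \<union> sides n"
  shows "\<not> crosses \<alpha> \<beta>"
proof -
  obtain i j where "\<alpha> = {i, j}" "i < j" using assms(1) edgeE by blast
  moreover obtain k l where "\<beta> = {k, l}" "1 \<le> k" "k < l" "l \<le> n + 3" using assms(2) edgeE by blast
  ultimately show ?thesis
    using assms(1) by (auto simp: crosses_iff sides_iff)
qed

section \<open>Triangulations through their triangles\<close>

text \<open>
  A description of triangulations by their triangles; unlike maximality, it is easily seen to be
  preserved by the flips below.
\<close>

definition triangulated :: "nat \<Rightarrow> nat set set \<Rightarrow> bool" where
  "triangulated n S \<longleftrightarrow>
     S \<subseteq> diagonals n \<and>
     (\<forall>\<alpha>\<in>S \<union> sides n. \<forall>\<beta>\<in>S \<union> sides n. \<not> crosses \<alpha> \<beta>) \<and>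
     (\<forall>i j. i + 2 \<le> j \<longrightarrow> {i, j} \<in> S \<union> sides n \<longrightarrow>
        (\<exists>k. i < k \<and> k < j \<and> {i, k} \<in> S \<union> sides n \<and> {k, j} \<in> S \<union> sides n))"

lemma triangulated_range:
  assumes "triangulated n S" "{i, j} \<in> S \<union> sides n" "i < j"
  shows "1 \<le> i" "j \<le> n + 3"
proof -
  have "{i, j} \<in> diagonals n \<union> sides n"
    using assms unfolding triangulated_def by blast
  then show "1 \<le> i" "j \<le> n + 3"
    using assms(3) by (auto simp: diagonals_iff sides_iff)
qed

lemma triangulated_not_interleaved:
  assumes "triangulated n S" "{i, j} \<in> S \<union> sides n" "{k, l} \<in> S \<union> sides n"
  shows "\<not> (i < k \<and> k < j \<and> j < l)"
proof
  assume "i < k \<and> k < j \<and> j < l"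
  then have "crosses {i, j} {k, l}" using assms by (subst crosses_iff) auto
  then show False using assms unfolding triangulated_def by blast
qed

lemma triangulated_triangle:
  assumes "triangulated n S" "{i, j} \<in> S \<union> sides n" "i + 2 \<le> j"
  obtains k where "i < k" "k < j" "{i, k} \<in> S \<union> sides n" "{k, j} \<in> S \<union> sides n"
  using assms unfolding triangulated_def by blast

text \<open>The apex over \<open>{i, j}\<close> is the largest \<open>k < j\<close> joined to
  \<open>i\<close>. If \<open>{k, j}\<close> were missing, maximality of \<open>T\<close> would
  supply a diagonal of \<open>T\<close> crossing it, and every position of that diagonal is
  contradictory.\<close>

lemma triangulation_imp_triangulated:
  assumes "triangulation n T"
  shows "triangulated n T"
proof -
  let ?E = "T \<union> sides n"
  have sub: "T \<subseteq> diagonals n"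
    using assms by (simp add: triangulation_def)
  then have noncross: "\<not> crosses \<alpha> \<beta>" if "\<alpha> \<in> ?E" "\<beta> \<in> ?E" for \<alpha> \<beta>
    using that assms not_crosses_side[of \<alpha> n \<beta>] not_crosses_side[of \<beta> n \<alpha>] crosses_sym[of \<alpha> \<beta>]
    unfolding triangulation_def by blast
  have interl: "\<not> (i < k \<and> k < j \<and> j < l)" if "{i, j} \<in> ?E" "{k, l} \<in> ?E" for i j k l
  proof
    assume "i < k \<and> k < j \<and> j < l"
    then have "crosses {i, j} {k, l}" by (subst crosses_iff) auto
    then show False using noncross that by blast
  qed
  have "\<exists>k. i < k \<and> k < j \<and> {i, k} \<in> ?E \<and> {k, j} \<in> ?E"
    if ij: "i + 2 \<le> j" "{i, j} \<in> ?E" for i j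
  proof -
    have "{i, j} \<in> diagonals n \<union> sides n"
      using ij(2) sub by blast
    then have range: "1 \<le> i" "j \<le> n + 3"
      using ij(1) by (auto simp: diagonals_iff sides_iff)
    define K where "K = {k. i < k \<and> k < j \<and> {i, k} \<in> ?E}"
    have "finite K"
      by (rule finite_subset[of _ "{..<j}"]) (auto simp: K_def)
    have "i + 1 \<in> K"
      using ij range by (auto simp: K_def sides_iff)
    define k where "k = Max K"
    have "k \<in> K"
      unfolding k_def using \<open>finite K\<close> \<open>i + 1 \<in> K\<close> by (intro Max_in) auto
    then have k: "i < k" "k < j" "{i, k} \<in> ?E"
      by (simp_all add: K_def)
    have k_max: "{i, l} \<notin> ?E" if "k < l" "l < j" for l
    proof
      assume "{i, l} \<in> ?E"
      then have "l \<in> K" using that k(1) by (simp add: K_def)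
      then show False using Max_ge[OF \<open>finite K\<close>, of l] that(1) by (simp add: k_def)
    qed
    have "{k, j} \<in> ?E"
    proof (rule ccontr)
      assume not_edge: "{k, j} \<notin> ?E"
      then have "{k, j} \<in> diagonals n"
        using k range by (auto simp: diagonals_iff sides_iff)
      then obtain \<delta> where \<delta>: "\<delta> \<in> T" "crosses {k, j} \<delta>"
        using assms not_edge unfolding triangulation_def by blast
      then obtain y z where yz: "\<delta> = {y, z}" "1 \<le> y" "y < z" "z \<le> n + 3"
        using sub edgeE by blast
      have yzE: "{y, z} \<in> ?E" using \<delta> yz by blast
      \<comment> \<open>In the first case \<open>{y, z}\<close> crosses \<open>{i, j}\<close>. In
        the second, \<open>y < i\<close> gives the same crossing, \<open>y = i\<close> contradicts
        the choice of \<open>k\<close>, and \<open>y > i\<close> gives a crossing with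
        \<open>{i, k}\<close>.\<close>
      from \<delta>(2) yz k(2) consider "k < y" "y < j" "j < z" | "y < k" "k < z" "z < j"
        by (auto simp: crosses_iff)
      then show False
      proof cases
        case 1
        then show False using interl[OF ij(2) yzE] k by arith
      next
        case 2
        then have "i \<le> y" using interl[OF yzE ij(2)] k by arith
        moreover have "y \<noteq> i" using k_max[of z] 2 yzE by blast
        ultimately show False using interl[OF k(3) yzE] 2 by arith
      qed
    qed
    with k show ?thesis by blast
  qed
  with sub noncross show ?thesis
    unfolding triangulated_def by blast
qed

text \<open>The flip takes place in the quadrilateral \<open>1, a, c, b\<close>. Afterwards
  \<open>{1, c}\<close> and \<open>{1, b}\<close> have the apexes \<open>a\<close> and
  \<open>c\<close>; all other edges keep their triangles.\<close>

lemma triangulated_flip: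
  assumes S: "triangulated n S"
    and less: "1 < a" "a < c" "c < b"
    and edges: "{1, a} \<in> S \<union> sides n" "{a, c} \<in> S \<union> sides n" "{c, b} \<in> S \<union> sides n" "{1, b} \<in> S \<union> sides n"
    and ab: "{a, b} \<in> S"
  shows "triangulated n (insert {1, c} (S - {{a, b}}))"
proof -
  let ?S = "insert {1, c} (S - {{a, b}})"
  note inter = triangulated_not_interleaved[OF S]
  have sub: "S \<subseteq> diagonals n"
    using S by (simp add: triangulated_def)
  have "b \<le> n + 3"
    using triangulated_range[OF S edges(4)] less by linarith
  then have c_diag: "{1, c} \<in> diagonals n"
    using less by (auto simp: diagonals_iff)
  have new: "\<not> crosses {1, c} \<beta>" if "\<beta> \<in> ?S \<union> sides n" for \<beta>
  proof
    assume cr: "crosses {1, c} \<beta>"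
    have "\<beta> \<in> diagonals n \<union> sides n"
      using that c_diag sub by blast
    then obtain y z where yz: "\<beta> = {y, z}" "1 \<le> y" "y < z"
      by (rule edgeE)
    have yz': "1 < y" "y < c" "c < z"
      using cr yz less by (auto simp: crosses_iff)
    then have E: "{y, z} \<in> S \<union> sides n" and ne: "{y, z} \<noteq> {a, b}"
      using that yz less ab sub by (auto simp: doubleton_eq_iff sides_iff diagonals_iff)
    \<comment> \<open>Noncrossing with the four sides of the quadrilateral leaves only the removed
      diagonal \<open>{a, b}\<close>.\<close>
    have "z \<le> b" using inter[OF edges(4) E] yz' less by arith
    moreover have "a \<le> y" using inter[OF edges(1) E] yz' less by arith
    moreover have "y \<le> a" using inter[OF edges(2) E] yz' less by arith
    moreover have "b \<le> z" using inter[OF E edges(3)] yz' less by arith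
    ultimately show False using ne by auto
  qed
  have noncross: "\<not> crosses \<alpha> \<beta>" if "\<alpha> \<in> ?S \<union> sides n" "\<beta> \<in> ?S \<union> sides n" for \<alpha> \<beta>
    using that new[of \<alpha>] new[of \<beta>] crosses_sym[of \<alpha> \<beta>] S unfolding triangulated_def by blast
  have triangle: "\<exists>k. i < k \<and> k < j \<and> {i, k} \<in> ?S \<union> sides n \<and> {k, j} \<in> ?S \<union> sides n"
    if ij: "i + 2 \<le> j" "{i, j} \<in> ?S \<union> sides n" for i j
  proof -
    have keep: "e \<in> ?S \<union> sides n" if "e \<in> S \<union> sides n" "e \<noteq> {a, b}" for e
      using that by blast
    consider "i = 1" "j = c" | "i = 1" "j = b" | "\<not> (i = 1 \<and> (j = c \<or> j = b))"
      by blast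
    then show ?thesis
    proof cases
      case 1
      then show ?thesis
        using less edges by (intro exI[of _ a]) (auto intro!: keep simp: doubleton_eq_iff)
    next
      case 2
      then show ?thesis
        using less keep[OF edges(3)] by (intro exI[of _ c]) (auto simp: doubleton_eq_iff)
    next
      case 3
      then have E: "{i, j} \<in> S \<union> sides n"
        using ij less by (auto simp: doubleton_eq_iff)
      then obtain k where k: "i < k" "k < j" "{i, k} \<in> S \<union> sides n" "{k, j} \<in> S \<union> sides n"
        using triangulated_triangle[OF S E ij(1)] by blast
      have "1 \<le> i" using triangulated_range[OF S E] ij by linarith
      \<comment> \<open>If \<open>{a, b}\<close> were a leg of this triangle, \<open>{i, j}\<close>
        would cross \<open>{1, b}\<close> in the first case and \<open>{1, a}\<close> in the
        second.\<close>
      have "{i, k} \<noteq> {a, b}"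
        using inter[OF edges(4) E] k less by (auto simp: doubleton_eq_iff)
      moreover have "{k, j} \<noteq> {a, b}"
        using inter[OF edges(1) E] k less 3 \<open>1 \<le> i\<close> by (auto simp: doubleton_eq_iff)
      ultimately show ?thesis
        using k keep by blast
    qed
  qed
  show ?thesis
    unfolding triangulated_def
  proof (intro conjI ballI allI impI)
    show "?S \<subseteq> diagonals n" using c_diag sub by blast
  qed (fact noncross triangle)+
qed


subsection \<open>Reaching every diagonal\<close>

text \<open>
  As long as some \<open>{1, k}\<close> is missing, a flip adds one; the quadrilateral to flip is found at the
  largest such \<open>k\<close>.
\<close>

lemma seed_fan:
  assumes "seed n T \<l> S x" "triangulated n S"
  shows "\<exists>S' x'. seed n T \<l> S' x' \<and> (\<forall>k\<in>{2..n + 3}. {1, k} \<in> S' \<union> sides n)"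
  using assms
proof (induction "card {k\<in>{2..n + 3}. {1, k} \<notin> S \<union> sides n}" arbitrary: S x rule: less_induct)
  case less
  define M where "M = {k\<in>{2..n + 3}. {1, k} \<notin> S \<union> sides n}"
  note S = less.prems(2)
  show ?case
  proof (cases "M = {}")
    case True
    then show ?thesis using less.prems(1) unfolding M_def by blast
  next
    case False
    have "finite M" by (simp add: M_def)
    define k where "k = Max M"
    have "k \<in> M" using False \<open>finite M\<close> by (simp add: k_def)
    \<comment> \<open>The two sides at vertex 1 are never missing, so \<open>k + 1\<close> is still
      a vertex.\<close>
    have "{1, 2} \<in> sides n" "{1, n + 3} \<in> sides n"
      by (simp_all add: sides_iff)
    with \<open>k \<in> M\<close> have k: "3 \<le> k" "k \<le> n + 2" "{1, k} \<notin> S \<union> sides n"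
      by (cases "k = n + 3"; cases "k = 2"; force simp: M_def)+
    \<comment> \<open>Maximality of \<open>k\<close> makes \<open>{1, b}\<close> an edge. Its apex
      \<open>a\<close> differs from \<open>k\<close>, so \<open>{a, b}\<close> is not a side and has
      a triangle of its own, with apex \<open>c\<close>. The two triangles form the quadrilateral to
      flip.\<close>
    define b where "b = k + 1"
    have "b \<notin> M"
      using Max_ge[OF \<open>finite M\<close>, of b] by (auto simp: k_def b_def)
    then have b: "{1, b} \<in> S \<union> sides n"
      using k by (auto simp: M_def b_def)
    then obtain a where a: "1 < a" "a < b" "{1, a} \<in> S \<union> sides n" "{a, b} \<in> S \<union> sides n"
      using triangulated_triangle[OF S b] k by (auto simp: b_def)
    have "a \<noteq> k" using a(3) k(3) by blast
    then have ab: "a + 2 \<le> b" using a by (simp add: b_def)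
    then obtain c where c: "a < c" "c < b" "{a, c} \<in> S \<union> sides n" "{c, b} \<in> S \<union> sides n"
      using triangulated_triangle[OF S a(4)] by blast
    have "{a, b} \<notin> sides n"
      using a ab by (simp add: sides_iff)
    then have "{a, b} \<in> S" using a by blast
    have "{1, c} \<notin> S \<union> sides n"
      using triangulated_not_interleaved[OF S _ a(4), of 1 c] a c by auto
    let ?S = "insert {1, c} (S - {{a, b}})"
    have "c \<le> n + 3"
      using triangulated_range(2)[OF S b] a c by simp
    \<comment> \<open>As \<open>a > 1\<close>, removing \<open>{a, b}\<close> loses no edge at
      vertex 1, while \<open>{1, c}\<close> is gained.\<close>
    have "{k\<in>{2..n + 3}. {1, k} \<notin> ?S \<union> sides n} \<subset> M"
    proof
      show "{k\<in>{2..n + 3}. {1, k} \<notin> ?S \<union> sides n} \<subseteq> M"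
        using a by (auto simp: M_def doubleton_eq_iff)
      have "c \<in> M" using \<open>{1, c} \<notin> _\<close> \<open>c \<le> n + 3\<close> a c by (simp add: M_def)
      then show "{k\<in>{2..n + 3}. {1, k} \<notin> ?S \<union> sides n} \<noteq> M" by blast
    qed
    then have "card {k\<in>{2..n + 3}. {1, k} \<notin> ?S \<union> sides n} < card M"
      using \<open>finite M\<close> by (intro psubset_card_mono)
    moreover have "triangulated n ?S"
      using triangulated_flip[OF S] a b c \<open>{a, b} \<in> S\<close> by blast
    moreover have "\<exists>x'. seed n T \<l> ?S x'"
    proof
      have "crosses {a, b} {1, c}"
        using a c by (simp add: crosses_iff)
      then show "seed n T \<l> ?S (x({1, c} := (x {a, 1} * x {b, c} + x {1, b} * x {c, a}) / x {a, b}))"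
        using a b c \<open>{a, b} \<in> S\<close> less.prems(1) by (intro flip) (auto simp: insert_commute)
    qed
    ultimately show ?thesis
      using less.hyps unfolding M_def by blast
  qed
qed

text \<open>The diagonals \<open>{1, u + 1}\<close>, \<open>{1, u + 2}\<close>, ... are flipped in
  turn: in the quadrilateral \<open>1, u, m, m + 1\<close> the flip of \<open>{1, m}\<close>
  produces \<open>{u, m + 1}\<close>. The invariant keeps the edges that bound the next
  quadrilateral.\<close>

lemma seed_from_fan:
  assumes "seed n T \<l> S x" "\<forall>k\<in>{2..n + 3}. {1, k} \<in> S \<union> sides n"
    and "2 \<le> u" "u + 1 \<le> m" "m \<le> n + 3"
  shows "\<exists>S' x'. seed n T \<l> S' x' \<and> {u, m} \<in> S' \<union> sides n \<and> {1, u} \<in> S' \<union> sides n \<and>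
           (\<forall>k\<in>{m..n + 3}. {1, k} \<in> S' \<union> sides n)"
  using assms(4,5)
proof (induction m rule: dec_induct)
  case base
  have "{u, u + 1} \<in> sides n" using base assms(3) by (simp add: sides_iff)
  then show ?case
    using assms base by (intro exI[of _ S] exI[of _ x]) auto
next
  case (step m)
  then obtain S' x' where S': "seed n T \<l> S' x'" "{u, m} \<in> S' \<union> sides n" "{1, u} \<in> S' \<union> sides n"
    "\<forall>k\<in>{m..n + 3}. {1, k} \<in> S' \<union> sides n"
    by auto
  have "{1, m} \<in> S' \<union> sides n" "{1, Suc m} \<in> S' \<union> sides n" using S'(4) step by auto
  moreover have "{1, m} \<notin> sides n" using step assms(3) by (simp add: sides_iff)
  ultimately have "{1, m} \<in> S'" by blast
  have "{m, Suc m} \<in> sides n" using step assms(3) by (simp add: sides_iff)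
  have "crosses {1, m} {u, Suc m}" using step assms(3) by (simp add: crosses_iff)
  let ?S = "insert {u, Suc m} (S' - {{1, m}})"
  have "seed n T \<l> ?S (x'({u, Suc m} :=
      (x' {1, u} * x' {m, Suc m} + x' {u, m} * x' {Suc m, 1}) / x' {1, m}))"
    by (intro flip S' \<open>crosses _ _\<close> \<open>{1, m} \<in> S'\<close>)
      (use \<open>{m, Suc m} \<in> sides n\<close> \<open>{1, Suc m} \<in> _\<close> in \<open>auto simp: insert_commute\<close>)
  moreover have "{1, u} \<in> ?S \<union> sides n" using S'(3) step by (auto simp: doubleton_eq_iff)
  moreover have "\<forall>k\<in>{Suc m..n + 3}. {1, k} \<in> ?S \<union> sides n"
    using S'(4) by (auto simp: doubleton_eq_iff)
  ultimately show ?case by blast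
qed

text \<open>The route passes through the fan at vertex 1, which contains the diagonals at that
  vertex and from which \<open>seed_from_fan\<close> produces the others.\<close>

lemma seed_reaches:
  assumes "triangulated n T" "\<gamma> \<in> diagonals n"
  shows "\<exists>S x. seed n T \<l> S x \<and> \<gamma> \<in> S"
proof -
  obtain i j where ij: "\<gamma> = {i, j}" "1 \<le> i" "i + 2 \<le> j" "j \<le> n + 3" "\<not> (i = 1 \<and> j = n + 3)"
    using assms(2) by (rule diagonalE)
  obtain S x where S: "seed n T \<l> S x" "\<forall>k\<in>{2..n + 3}. {1, k} \<in> S \<union> sides n"
    using seed_fan[OF seed.initial assms(1)] by blast
  have "\<gamma> \<notin> sides n" using ij by (simp add: sides_iff)
  moreover have "\<exists>S x. seed n T \<l> S x \<and> \<gamma> \<in> S \<union> sides n"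
  proof (cases "i = 1")
    case True
    then have "\<gamma> \<in> S \<union> sides n" using S ij by auto
    then show ?thesis using S(1) by blast
  next
    case False
    then show ?thesis using seed_from_fan[OF S, of i j] ij by auto
  qed
  ultimately show ?thesis by blast
qed


subsection \<open>Cluster variables as minors\<close>

definition det2 :: "'a \<times> 'a \<Rightarrow> 'a \<times> 'a \<Rightarrow> 'a::comm_ring_1" where
  "det2 p q = fst p * snd q - snd p * fst q"

text \<open>A Pluecker coordinate of the matrix with columns \<open>v i\<close>. Taking the columns
  in increasing order fixes the sign, so that it depends on the edge only.\<close>

definition minor :: "(nat \<Rightarrow> 'a \<times> 'a) \<Rightarrow> nat set \<Rightarrow> 'a::comm_ring_1" where
  "minor v e = det2 (v (Min e)) (v (Max e))"

lemma minor_less: "i < j \<Longrightarrow> minor v {i, j} = det2 (v i) (v j)"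
  by (simp add: minor_def min_def max_def)

text \<open>The three-term Pluecker relation for \<open>a < b < c < d\<close>. The eight ways to
  match \<open>p, q, r, s\<close> with these vertices are the symmetries of the quadrilateral, which
  preserve the relation.\<close>

lemma minor_ptolemy:
  assumes "crosses {p, r} {q, s}"
  shows "minor v {p, r} * minor v {q, s} = minor v {p, q} * minor v {r, s} + minor v {q, r} * minor v {s, p}"
proof -
  obtain a b c d where less: "a < b" "b < c" "c < d"
    and "{p, r} = {a, c} \<and> {q, s} = {b, d} \<or> {p, r} = {b, d} \<and> {q, s} = {a, c}"
    using assms unfolding crosses_def by blast
  then have *: "p = a \<and> r = c \<and> q = b \<and> s = d \<or> p = c \<and> r = a \<and> q = b \<and> s = d \<or>
    p = a \<and> r = c \<and> q = d \<and> s = b \<or> p = c \<and> r = a \<and> q = d \<and> s = b \<or>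
    p = b \<and> r = d \<and> q = a \<and> s = c \<or> p = b \<and> r = d \<and> q = c \<and> s = a \<or>
    p = d \<and> r = b \<and> q = a \<and> s = c \<or> p = d \<and> r = b \<and> q = c \<and> s = a"
    by (auto simp: doubleton_eq_iff)
  have "minor v {a, c} * minor v {b, d} = minor v {a, b} * minor v {c, d} + minor v {b, c} * minor v {a, d}"
    using less by (simp add: minor_less det2_def algebra_simps)
  with * show ?thesis
    by (auto simp: insert_commute algebra_simps)
qed

text \<open>Induction on \<open>j - i\<close>: the apex of the triangle over \<open>{i, j}\<close>
  receives a vector fitting both legs, and the parts over the legs are filled separately. Fixing
  both end vectors allows gluing at the apex; the only edge in range that passes over the apex is
  \<open>{i, j}\<close> itself.\<close>

lemma minors_prescribed_between:
  fixes w :: "nat set \<Rightarrow> 'a::field"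
  assumes S: "triangulated n S" and w: "\<And>e. e \<in> S \<union> sides n \<Longrightarrow> w e \<noteq> 0"
    and "i < j" "{i, j} \<in> S \<union> sides n" "det2 p q = w {i, j}"
  shows "\<exists>v. v i = p \<and> v j = q \<and>
    (\<forall>k l. i \<le> k \<longrightarrow> k < l \<longrightarrow> l \<le> j \<longrightarrow> {k, l} \<in> S \<union> sides n \<longrightarrow> det2 (v k) (v l) = w {k, l})"
  using assms(3-)
proof (induction "j - i" arbitrary: i j p q rule: less_induct)
  case less
  show ?case
  proof (cases "j = i + 1")
    case True
    have "k = i \<and> l = j" if "i \<le> k" "k < l" "l \<le> j" for k l
      using that True by linarith
    then show ?thesis
      using less.prems by (intro exI[of _ "\<lambda>m. if m = i then p else q"]) auto
  next
    case False
    then obtain m where m: "i < m" "m < j" "{i, m} \<in> S \<union> sides n" "{m, j} \<in> S \<union> sides n"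
      using triangulated_triangle[OF S less.prems(2)] less.prems(1) by auto
    text \<open>By Cramer's rule this is the only vector with the required minors with \<open>p\<close> and \<open>q\<close>.\<close>
    define r where "r = ((w {m, j} * fst p + w {i, m} * fst q) / w {i, j},
                         (w {m, j} * snd p + w {i, m} * snd q) / w {i, j})"
    have "w {i, j} \<noteq> 0" using w less.prems by blast
    then have "det2 p r = w {i, m} * det2 p q / w {i, j}" "det2 r q = w {m, j} * det2 p q / w {i, j}"
      by (simp_all add: det2_def r_def field_simps)
    then have det: "det2 p r = w {i, m}" "det2 r q = w {m, j}"
      using \<open>w {i, j} \<noteq> 0\<close> less.prems(3) by simp_all
    obtain v1 where v1: "v1 i = p" "v1 m = r"
      "\<And>k l. i \<le> k \<Longrightarrow> k < l \<Longrightarrow> l \<le> m \<Longrightarrow> {k, l} \<in> S \<union> sides n \<Longrightarrow> det2 (v1 k) (v1 l) = w {k, l}"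
      using less.hyps[OF _ m(1,3) det(1)] m by (metis diff_less_mono less_imp_le)
    obtain v2 where v2: "v2 m = r" "v2 j = q"
      "\<And>k l. m \<le> k \<Longrightarrow> k < l \<Longrightarrow> l \<le> j \<Longrightarrow> {k, l} \<in> S \<union> sides n \<Longrightarrow> det2 (v2 k) (v2 l) = w {k, l}"
      using less.hyps[OF _ m(2,4) det(2)] m by (metis diff_less_mono2 less.prems(1))
    \<comment> \<open>Both partial families take the value \<open>r\<close> at
      \<open>m\<close>.\<close>
    define v where "v k = (if k \<le> m then v1 k else v2 k)" for k
    have v_eq: "v k = v2 k" if "m \<le> k" for k
      using that v1(2) v2(1) by (auto simp: v_def)
    have "det2 (v k) (v l) = w {k, l}"
      if kl: "i \<le> k" "k < l" "l \<le> j" "{k, l} \<in> S \<union> sides n" for k l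
    proof -
      consider "l \<le> m" | "m \<le> k" | "k < m" "m < l" by linarith
      then show ?thesis
      proof cases
        case 1
        then show ?thesis using v1(3) kl by (simp add: v_def)
      next
        case 2
        then show ?thesis using v2(3) kl by (simp add: v_eq)
      next
        case 3
        have "k = i"
          using triangulated_not_interleaved[OF S m(3) kl(4)] 3 kl by linarith
        moreover have "l = j"
          using triangulated_not_interleaved[OF S kl(4) m(4)] 3 kl by linarith
        ultimately show ?thesis
          using v1(1) v2(2) v_eq m less.prems(3) by (simp add: v_def)
      qed
    qed
    moreover have "v i = p" "v j = q"
      using v1(1) v2(2) m by (simp_all add: v_def)
    ultimately show ?thesis by blast
  qed
qed

lemma minors_prescribed:
  fixes w :: "nat set \<Rightarrow> 'a::field"
  assumes S: "triangulated n S" and w: "\<And>e. e \<in> S \<union> sides n \<Longrightarrow> w e \<noteq> 0"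
  shows "\<exists>v. \<forall>e\<in>S \<union> sides n. minor v e = w e"
proof -
  \<comment> \<open>Every edge lies in the range from \<open>1\<close> to \<open>n + 3\<close>, and
    these two vectors have the determinant demanded on the side joining them.\<close>
  have "\<exists>v. v 1 = (1, 0) \<and> v (n + 3) = (0, w {1, n + 3}) \<and>
    (\<forall>k l. 1 \<le> k \<longrightarrow> k < l \<longrightarrow> l \<le> n + 3 \<longrightarrow> {k, l} \<in> S \<union> sides n \<longrightarrow> det2 (v k) (v l) = w {k, l})"
    using w by (intro minors_prescribed_between[OF S]) (auto simp: sides_iff det2_def)
  then obtain v where
    v: "\<And>k l. 1 \<le> k \<Longrightarrow> k < l \<Longrightarrow> l \<le> n + 3 \<Longrightarrow> {k, l} \<in> S \<union> sides n \<Longrightarrow> det2 (v k) (v l) = w {k, l}"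
    by blast
  have "minor v e = w e" if e: "e \<in> S \<union> sides n" for e
  proof -
    have "e \<in> diagonals n \<union> sides n" using e S unfolding triangulated_def by blast
    then obtain i j where "e = {i, j}" "1 \<le> i" "i < j" "j \<le> n + 3" by (rule edgeE)
    with v[of i j] e show ?thesis by (simp add: minor_less)
  qed
  then show ?thesis by blast
qed

section \<open>Values and well-definedness of cluster variables\<close>

text \<open>The vectors \<open>s\<^sub>i (1, i)\<close> realise the values \<open>s\<^sub>i s\<^sub>j (j - i)\<close>.\<close>

definition moment_vec :: "(nat \<Rightarrow> rat) \<Rightarrow> nat \<Rightarrow> rat \<times> rat" where
  "moment_vec s i = (s i, s i * of_nat i)"

lemma minor_moment_vec:
  "i < j \<Longrightarrow> minor (moment_vec s) {i, j} = s i * s j * of_nat (j - i)"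
  by (simp add: minor_less det2_def moment_vec_def of_nat_diff algebra_simps)

lemma minor_moment_vec_nonzero:
  assumes "\<And>i. s i \<noteq> 0" "i \<noteq> j"
  shows "minor (moment_vec s) {i, j} \<noteq> 0"
  using assms minor_moment_vec[of i j s] minor_moment_vec[of j i s]
  by (cases "i < j") (auto simp: insert_commute)

text \<open>The point of evaluation: \<open>inv_into\<close> recovers the edge from its label, so
  each initial variable takes the value of the minor of its edge.\<close>

definition edge_values :: "nat \<Rightarrow> nat set set \<Rightarrow> (nat set \<Rightarrow> 'v) \<Rightarrow> (nat \<Rightarrow> rat) \<Rightarrow> 'v \<Rightarrow> rat" where
  "edge_values n T \<l> s a = minor (moment_vec s) (inv_into (T \<union> sides n) \<l> a)"

text \<open>The minors satisfy the exchange relation, and the divisor in a flip has a nonzero value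
  because its endpoints are distinct and all scalars are nonzero.\<close>

lemma seed_evaluates:
  assumes "seed n T \<l> S x" "inj_on \<l> (T \<union> sides n)" "\<And>i. s i \<noteq> 0" "e \<in> S \<union> sides n"
  shows "evaluates (edge_values n T \<l> s) (x e) (minor (moment_vec s) e)"
  using assms(1,4)
proof (induction arbitrary: e rule: seed.induct)
  case initial
  then have "edge_values n T \<l> s (\<l> e) = minor (moment_vec s) e"
    using assms(2) by (simp add: edge_values_def)
  then show ?case
    using evaluates_indet[of "edge_values n T \<l> s" "\<l> e"] by simp
next
  case (flip S x p r q s')
  let ?m = "minor (moment_vec s)"
  show ?case
  proof (cases "e = {q, s'}")
    case True
    have "p \<noteq> r" using flip.hyps(3) by (auto simp: crosses_def doubleton_eq_iff)
    then have nz: "?m {p, r} \<noteq> 0" by (rule minor_moment_vec_nonzero[OF assms(3)])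
    have "?m e = (?m {p, q} * ?m {r, s'} + ?m {q, r} * ?m {s', p}) / ?m {p, r}"
      using minor_ptolemy[OF flip.hyps(3), of "moment_vec s"] nz True by (simp add: field_simps)
    then show ?thesis
      using True flip nz by (auto intro!: evaluates_divide evaluates_add evaluates_mult)
  next
    case False
    then show ?thesis using flip.IH flip.prems by auto
  qed
qed

text \<open>A flip solves for the new variable the very relation that the minors satisfy, so the
  equality persists along every flip sequence.\<close>

lemma seed_eq_minor:
  assumes "seed n T \<l> S x" "inj_on \<l> (T \<union> sides n)"
    and v: "\<And>e. e \<in> T \<union> sides n \<Longrightarrow> minor v e = indet (\<l> e)"
    and "e \<in> S \<union> sides n"
  shows "x e = minor v e"
  using assms(1,4)
proof (induction arbitrary: e rule: seed.induct)
  case initial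
  then show ?case using v by simp
next
  case (flip S x p r q s)
  show ?case
  proof (cases "e = {q, s}")
    case True
    have "p \<noteq> r" using flip.hyps(3) by (auto simp: crosses_def doubleton_eq_iff)
    \<comment> \<open>The divisor \<open>x {p, r}\<close> is nonzero since it has a nonzero value at
      the vectors \<open>(1, i)\<close>.\<close>
    then have "minor (moment_vec (\<lambda>_. 1)) {p, r} \<noteq> 0"
      by (intro minor_moment_vec_nonzero) auto
    moreover have "evaluates (edge_values n T \<l> (\<lambda>_. 1)) (x {p, r}) (minor (moment_vec (\<lambda>_. 1)) {p, r})"
      by (rule seed_evaluates[OF flip.hyps(1) assms(2)]) (use flip.hyps in auto)
    ultimately have "x {p, r} \<noteq> 0" by auto
    moreover have "x {p, r} = minor v {p, r}" "x {p, q} = minor v {p, q}" "x {r, s} = minor v {r, s}"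
      "x {q, r} = minor v {q, r}" "x {s, p} = minor v {s, p}"
      using flip.IH flip.hyps by auto
    ultimately show ?thesis
      using True minor_ptolemy[OF flip.hyps(3), of v] by (simp add: field_simps)
  next
    case False
    then show ?thesis using flip.IH flip.prems by auto
  qed
qed

text \<open>Well-definedness: all flip sequences reaching \<open>\<gamma>\<close> compute the same
  minor of one family \<open>v\<close> chosen from the initial triangulation.\<close>

lemma cluster_var_eq:
  assumes T: "triangulated n T" and inj: "inj_on \<l> (T \<union> sides n)"
    and S: "seed n T \<l> S x" "\<gamma> \<in> S"
  shows "cluster_var n T \<l> \<gamma> = x \<gamma>"
proof -
  have "indet (\<l> e) \<noteq> 0" for e
    using evaluates_indet[of "\<lambda>_. 1" "\<l> e"] by auto
  then obtain v where "\<And>e. e \<in> T \<union> sides n \<Longrightarrow> minor v e = indet (\<l> e)"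
    using minors_prescribed[OF T, of "\<lambda>e. indet (\<l> e)"] by blast
  note eq = seed_eq_minor[OF _ inj this]
  show ?thesis
    unfolding cluster_var_def
  proof (rule the_equality)
    show "\<exists>S' x'. seed n T \<l> S' x' \<and> \<gamma> \<in> S' \<and> x' \<gamma> = x \<gamma>" using S by blast
    show "f = x \<gamma>" if "\<exists>S' x'. seed n T \<l> S' x' \<and> \<gamma> \<in> S' \<and> x' \<gamma> = f" for f
      using that eq S by (metis UnI1)
  qed
qed

lemma cluster_var_evaluates:
  assumes "triangulated n T" "inj_on \<l> (T \<union> sides n)" "\<And>i. s i \<noteq> 0" "\<gamma> \<in> diagonals n"
  shows "evaluates (edge_values n T \<l> s) (cluster_var n T \<l> \<gamma>) (minor (moment_vec s) \<gamma>)"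
proof -
  obtain S x where S: "seed n T \<l> S x" "\<gamma> \<in> S"
    using seed_reaches[OF assms(1,4)] by blast
  then show ?thesis
    using seed_evaluates[OF S(1) assms(2,3), of \<gamma>] cluster_var_eq[OF assms(1,2) S] by auto
qed

text \<open>
  The value of \<open>x\<^sub>i\<^sub>j\<close> is \<open>s\<^sub>i s\<^sub>j (j - i)\<close>, so the mixed second difference in \<open>s\<^sub>i\<close> and \<open>s\<^sub>j\<close>
  extracts the coefficient of \<open>x\<^sub>i\<^sub>j\<close> from a linear relation.
\<close>

lemma cluster_vars_independent:
  fixes c :: "nat set \<Rightarrow> int"
  assumes T: "triangulated n T" and inj: "inj_on \<l> (T \<union> sides n)"
    and zero: "(\<Sum>\<gamma>\<in>diagonals n. of_int (c \<gamma>) * cluster_var n T \<l> \<gamma>) = 0"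
    and "\<gamma> \<in> diagonals n"
  shows "c \<gamma> = 0"
proof -
  obtain i j where ij: "\<gamma> = {i, j}" "i < j"
    using assms(4) edgeE by blast
  \<comment> \<open>Scalars 2 on \<open>A\<close> and 1 elsewhere: passing from 1 to 2 is a unit
    step, so the mixed difference at \<open>i\<close> and \<open>j\<close> multiplies
    \<open>j - i\<close> by 1.\<close>
  define t :: "nat set \<Rightarrow> nat \<Rightarrow> rat" where "t A k = (if k \<in> A then 2 else 1)" for A k
  define m where "m A = minor (moment_vec (t A))" for A
  have vanish: "(\<Sum>\<delta>\<in>diagonals n. of_int (c \<delta>) * m A \<delta>) = 0" for A
  proof -
    have "t A k \<noteq> 0" for k by (simp add: t_def)
    then have "evaluates (edge_values n T \<l> (t A)) (\<Sum>\<delta>\<in>diagonals n. of_int (c \<delta>) * cluster_var n T \<l> \<delta>)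
        (\<Sum>\<delta>\<in>diagonals n. of_int (c \<delta>) * m A \<delta>)"
      unfolding m_def
      by (intro evaluates_sum evaluates_mult evaluates_of_int cluster_var_evaluates[OF T inj]) auto
    then show ?thesis by (simp add: zero)
  qed
  have "m {i, j} \<delta> - m {i} \<delta> - m {j} \<delta> + m {} \<delta> = (if \<delta> = \<gamma> then of_nat (j - i) else 0)"
    if \<delta>: "\<delta> \<in> diagonals n" for \<delta>
  proof -
    obtain k l where kl: "\<delta> = {k, l}" "k < l" using \<delta> edgeE by blast
    then show ?thesis
      using ij by (auto simp: m_def minor_moment_vec t_def doubleton_eq_iff)
  qed
  then have "of_int (c \<gamma>) * of_nat (j - i) =
    (\<Sum>\<delta>\<in>diagonals n. of_int (c \<delta>) * (m {i, j} \<delta> - m {i} \<delta> - m {j} \<delta> + m {} \<delta>))"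
    using assms(4) finite_diagonals by (simp add: if_distrib[of "\<lambda>x. _ * x"] sum.delta cong: if_cong)
  also have "\<dots> = 0"
    by (simp add: algebra_simps sum.distrib sum_subtractf vanish)
  finally show ?thesis using ij by simp
qed


subsection \<open>The crossing pairs through a vertex\<close>

definition crossing_pairs_at_1 :: "nat \<Rightarrow> (nat set \<times> nat set) set" where
  "crossing_pairs_at_1 n =
     {(\<alpha>, \<beta>). \<alpha> \<in> diagonals n \<and> \<beta> \<in> diagonals n \<and> crosses \<alpha> \<beta> \<and> 1 \<in> \<alpha>}"

text \<open>Vertex 1 is the smallest of the four endpoints, so its partner \<open>c\<close> is the
  middle one of the other three.\<close>

lemma crossing_pairs_at_1_eq:
  "crossing_pairs_at_1 n = {({1, c}, {b, d}) | b c d. 2 \<le> b \<and> b < c \<and> c < d \<and> d \<le> n + 3}"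
proof (intro equalityI subsetI)
  fix z assume "z \<in> crossing_pairs_at_1 n"
  then obtain \<alpha> \<beta> where z: "z = (\<alpha>, \<beta>)" and \<alpha>: "\<alpha> \<in> diagonals n" and \<beta>: "\<beta> \<in> diagonals n"
    and cr: "crosses \<alpha> \<beta>" "1 \<in> \<alpha>"
    by (auto simp: crossing_pairs_at_1_def)
  obtain i c where ic: "\<alpha> = {i, c}" "1 \<le> i" "i + 2 \<le> c" "c \<le> n + 3" using \<alpha> by (rule diagonalE)
  obtain b d where bd: "\<beta> = {b, d}" "1 \<le> b" "b + 2 \<le> d" "d \<le> n + 3" using \<beta> by (rule diagonalE)
  have "i = 1" using ic cr(2) by auto
  then have "1 < b \<and> b < c \<and> c < d" using cr(1) ic bd by (auto simp: crosses_iff)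
  then show "z \<in> {({1, c}, {b, d}) | b c d. 2 \<le> b \<and> b < c \<and> c < d \<and> d \<le> n + 3}"
    using z ic bd \<open>i = 1\<close> by auto
next
  fix z assume "z \<in> {({1, c}, {b, d}) | b c d. 2 \<le> b \<and> b < c \<and> c < d \<and> d \<le> n + 3}"
  then show "z \<in> crossing_pairs_at_1 n"
    by (auto simp: crossing_pairs_at_1_def diagonals_iff crosses_iff)
qed

lemma three_elementsE:
  fixes K :: "'a::linorder set"
  assumes "card K = 3"
  obtains b c d where "K = {b, c, d}" "b < c" "c < d"
proof -
  obtain x y z where K: "K = {x, y, z}" "x \<noteq> y" "x \<noteq> z" "y \<noteq> z"
    using assms by (auto simp: card_3_iff)
  then consider "x < y" "y < z" | "x < z" "z < y" | "y < x" "x < z" | "y < z" "z < x"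
    | "z < x" "x < y" | "z < y" "y < x"
    by (metis linorder_less_linear)
  then show ?thesis
    using K(1) that[of x y z] that[of x z y] that[of y x z] that[of y z x] that[of z x y] that[of z y x]
    by cases (simp_all add: insert_commute)
qed

text \<open>The endpoints other than 1 form a 3-subset of the remaining \<open>n + 2\<close>
  vertices; conversely, joining 1 to the middle element recovers the pair.\<close>

lemma card_crossing_pairs_at_1: "card (crossing_pairs_at_1 n) = (n + 2) choose 3"
proof -
  let ?K = "{K. K \<subseteq> {2..n + 3} \<and> card K = 3}"
  let ?f = "\<lambda>(\<alpha>, \<beta>). (\<alpha> - {1}) \<union> \<beta>"
  have "bij_betw ?f (crossing_pairs_at_1 n) ?K"
  proof (rule bij_betwI')
    fix z z' assume "z \<in> crossing_pairs_at_1 n" "z' \<in> crossing_pairs_at_1 n"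
    then obtain b c d b' c' d' where z: "z = ({1, c}, {b, d})" "2 \<le> b" "b < c" "c < d"
      and z': "z' = ({1, c'}, {b', d'})" "2 \<le> b'" "b' < c'" "c' < d'"
      by (auto simp: crossing_pairs_at_1_eq)
    have f: "?f z = {b, c, d}" "?f z' = {b', c', d'}"
      using z z' by auto
    show "(?f z = ?f z') = (z = z')"
    proof
      assume "?f z = ?f z'"
      then have eq: "{b, c, d} = {b', c', d'}" unfolding f .
      have sorted: "sorted_list_of_set {x, y, w} = [x, y, w]" if "x < y" "y < w" for x y w :: nat
        using sorted_list_of_set.idem_if_sorted_distinct[of "[x, y, w]"] that by simp
      have "[b, c, d] = [b', c', d']"
        using sorted[OF z(3,4)] sorted[OF z'(3,4)] unfolding eq by (rule trans[OF sym])
      then show "z = z'" using z(1) z'(1) by simp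
    qed simp
  next
    fix z assume "z \<in> crossing_pairs_at_1 n"
    then obtain b c d where "z = ({1, c}, {b, d})" "2 \<le> b" "b < c" "c < d" "d \<le> n + 3"
      by (auto simp: crossing_pairs_at_1_eq)
    moreover from this have "?f z = {b, c, d}" by auto
    ultimately show "?f z \<in> ?K" by simp
  next
    fix K assume K: "K \<in> ?K"
    then have "card K = 3" by simp
    then obtain b c d where bcd: "K = {b, c, d}" "b < c" "c < d" by (rule three_elementsE)
    then have "({1, c}, {b, d}) \<in> crossing_pairs_at_1 n"
      using K by (auto simp: crossing_pairs_at_1_eq)
    moreover have "K = ?f ({1, c}, {b, d})" using bcd K by auto
    ultimately show "\<exists>z\<in>crossing_pairs_at_1 n. K = ?f z" by blast
  qed
  then have "card (crossing_pairs_at_1 n) = card ?K" by (rule bij_betw_same_card)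
  also have "\<dots> = card {2..n + 3} choose 3" by (rule n_subsets) simp
  finally show ?thesis by simp
qed

section \<open>Spanning and independence of differences\<close>

text \<open>All diagonals \<open>{1, k}\<close> cross \<open>{2, n + 3}\<close>, and every other diagonal crosses some \<open>{1, k}\<close>.\<close>

lemma differences_in_span:
  fixes X :: "nat set \<Rightarrow> 'a::comm_ring_1"
  assumes "n \<ge> 2" "\<alpha> \<in> diagonals n" "\<beta> \<in> diagonals n"
  shows "X \<alpha> - X \<beta> \<in> int_module.span ((\<lambda>(\<alpha>, \<beta>). X \<alpha> - X \<beta>) ` crossing_pairs_at_1 n)"
    (is "_ \<in> int_module.span ?G")
proof -
  have gen: "X {1, c} - X {b, d} \<in> int_module.span ?G" if "2 \<le> b" "b < c" "c < d" "d \<le> n + 3" for b c d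
  proof (rule int_module.span_base)
    have "({1, c}, {b, d}) \<in> crossing_pairs_at_1 n"
      using that by (auto simp: crossing_pairs_at_1_eq)
    then show "X {1, c} - X {b, d} \<in> ?G" by force
  qed
  have base: "X \<gamma> - X {2, n + 3} \<in> int_module.span ?G" if \<gamma>: "\<gamma> \<in> diagonals n" for \<gamma>
  proof -
    obtain i j where ij: "\<gamma> = {i, j}" "1 \<le> i" "i + 2 \<le> j" "j \<le> n + 3" "\<not> (i = 1 \<and> j = n + 3)"
      using \<gamma> by (rule diagonalE)
    show ?thesis
    proof (cases "i = 1")
      case True
      then show ?thesis using gen[of 2 j "n + 3"] ij by auto
    next
      case False
      \<comment> \<open>Both \<open>{i, j}\<close> and \<open>{2, n + 3}\<close> cross
        \<open>{1, i + 1}\<close>, whose variable cancels.\<close>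
      have "(X {1, i + 1} - X {2, n + 3}) - (X {1, i + 1} - X {i, j}) \<in> int_module.span ?G"
        using ij False by (intro int_module.span_diff[OF gen gen]) auto
      then show ?thesis using ij by simp
    qed
  qed
  have "(X \<alpha> - X {2, n + 3}) - (X \<beta> - X {2, n + 3}) \<in> int_module.span ?G"
    by (rule int_module.span_diff[OF base[OF assms(2)] base[OF assms(3)]])
  then show ?thesis by simp
qed

text \<open>A relation among the differences is one among the \<open>X \<gamma>\<close> in which the
  base element has minus the sum of the other coefficients.\<close>

lemma differences_to_base_independent:
  fixes X :: "'b \<Rightarrow> 'a::comm_ring_1"
  assumes "finite D"
    and indep: "\<And>c. (\<Sum>\<gamma>\<in>D. of_int (c \<gamma>) * X \<gamma>) = 0 \<Longrightarrow> \<forall>\<gamma>\<in>D. c \<gamma> = 0"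
    and "\<gamma>\<^sub>0 \<in> D"
  shows "int_module.independent ((\<lambda>\<gamma>. X \<gamma> - X \<gamma>\<^sub>0) ` (D - {\<gamma>\<^sub>0}))"
proof
  let ?f = "\<lambda>\<gamma>. X \<gamma> - X \<gamma>\<^sub>0"
  have zero_coeffs: "\<forall>\<gamma>\<in>D - {\<gamma>\<^sub>0}. c \<gamma> = 0" if "(\<Sum>\<gamma>\<in>D - {\<gamma>\<^sub>0}. of_int (c \<gamma>) * ?f \<gamma>) = 0"
    for c :: "'b \<Rightarrow> int"
  proof -
    let ?c = "c(\<gamma>\<^sub>0 := - (\<Sum>\<gamma>\<in>D - {\<gamma>\<^sub>0}. c \<gamma>))"
    have "(\<Sum>\<gamma>\<in>D. of_int (?c \<gamma>) * X \<gamma>) =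
        of_int (?c \<gamma>\<^sub>0) * X \<gamma>\<^sub>0 + (\<Sum>\<gamma>\<in>D - {\<gamma>\<^sub>0}. of_int (?c \<gamma>) * X \<gamma>)"
      by (rule sum.remove[OF assms(1,3)])
    also have "(\<Sum>\<gamma>\<in>D - {\<gamma>\<^sub>0}. of_int (?c \<gamma>) * X \<gamma>) = (\<Sum>\<gamma>\<in>D - {\<gamma>\<^sub>0}. of_int (c \<gamma>) * X \<gamma>)"
      by (rule sum.cong) auto
    also have "of_int (?c \<gamma>\<^sub>0) * X \<gamma>\<^sub>0 + \<dots> = (\<Sum>\<gamma>\<in>D - {\<gamma>\<^sub>0}. of_int (c \<gamma>) * ?f \<gamma>)"
      by (simp add: right_diff_distrib sum_subtractf sum_distrib_right)
    finally have "\<forall>\<gamma>\<in>D. ?c \<gamma> = 0" using that by (intro indep) simp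
    then show ?thesis by (metis DiffE fun_upd_other singletonI)
  qed
  \<comment> \<open>Dependence concerns the set of differences; injectivity lets its coefficients be
    indexed by \<open>D\<close> again.\<close>
  have inj: "inj_on ?f (D - {\<gamma>\<^sub>0})"
  proof (rule inj_onI, rule ccontr)
    fix \<gamma> \<delta> assume \<gamma>\<delta>: "\<gamma> \<in> D - {\<gamma>\<^sub>0}" "\<delta> \<in> D - {\<gamma>\<^sub>0}" "?f \<gamma> = ?f \<delta>" "\<gamma> \<noteq> \<delta>"
    let ?c = "\<lambda>\<epsilon>. if \<epsilon> = \<gamma> then 1 else if \<epsilon> = \<delta> then -1 else 0 :: int"
    have "(\<Sum>\<epsilon>\<in>D - {\<gamma>\<^sub>0}. of_int (?c \<epsilon>) * ?f \<epsilon>) = (\<Sum>\<epsilon>\<in>{\<gamma>, \<delta>}. of_int (?c \<epsilon>) * ?f \<epsilon>)"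
      using \<gamma>\<delta> assms(1) by (intro sum.mono_neutral_right) auto
    also have "\<dots> = 0" using \<gamma>\<delta> by simp
    finally have "?c \<gamma> = 0" using zero_coeffs[of ?c] \<gamma>\<delta>(1) by blast
    then show False by simp
  qed
  assume "int_module.dependent (?f ` (D - {\<gamma>\<^sub>0}))"
  then obtain t u where t: "finite t" "t \<subseteq> ?f ` (D - {\<gamma>\<^sub>0})" "(\<Sum>y\<in>t. of_int (u y) * y) = 0"
    and u: "\<exists>y\<in>t. u y \<noteq> 0"
    unfolding int_module.dependent_explicit by blast
  let ?c = "\<lambda>\<gamma>. if ?f \<gamma> \<in> t then u (?f \<gamma>) else 0"
  have "(\<Sum>\<gamma>\<in>D - {\<gamma>\<^sub>0}. of_int (?c \<gamma>) * ?f \<gamma>) =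
      (\<Sum>y\<in>?f ` (D - {\<gamma>\<^sub>0}). of_int (if y \<in> t then u y else 0) * y)"
    by (simp add: sum.reindex[OF inj] o_def)
  also have "\<dots> = (\<Sum>y\<in>t. of_int (if y \<in> t then u y else 0) * y)"
    using t assms(1) by (intro sum.mono_neutral_right) auto
  also have "\<dots> = 0" using t(3) by simp
  finally have "\<forall>\<gamma>\<in>D - {\<gamma>\<^sub>0}. ?c \<gamma> = 0" by (rule zero_coeffs)
  then show False using t(2) u by force
qed

theorem theorem1p3:
  fixes n :: nat and T :: "nat set set" and \<l> :: "nat set \<Rightarrow> 'v::linorder"
  assumes "n \<ge> 2"
    and "triangulation n T"
    and "bij_betw \<l> (T \<union> sides n) (UNIV :: 'v set)"
  shows "free_int_module (exchange_module n T \<l>) \<and>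
         exchange_module n T \<l> = int_module.span (exchange_generators n T \<l>) \<and>
         card (exchange_generators n T \<l>) = (n + 2) choose 3"
proof -
  let ?D = "diagonals n" and ?\<gamma> = "{2, n + 3}"
  define X where "X = cluster_var n T \<l>"
  have T: "triangulated n T" using assms(2) by (rule triangulation_imp_triangulated)
  have inj: "inj_on \<l> (T \<union> sides n)" using assms(3) by (rule bij_betw_imp_inj_on)
  have indep: "\<forall>\<gamma>\<in>?D. c \<gamma> = 0" if "(\<Sum>\<gamma>\<in>?D. of_int (c \<gamma>) * X \<gamma>) = 0" for c
    using cluster_vars_independent[OF T inj] that unfolding X_def by blast
  have gens: "exchange_generators n T \<l> = (\<lambda>(\<alpha>, \<beta>). X \<alpha> - X \<beta>) ` crossing_pairs_at_1 n"
    unfolding exchange_generators_def crossing_pairs_at_1_def X_def by force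
  have \<gamma>: "?\<gamma> \<in> ?D" using assms(1) by (simp add: diagonals_iff)
  \<comment> \<open>The basis: one difference for each diagonal other than
    \<open>{2, n + 3}\<close>.\<close>
  let ?B = "(\<lambda>\<gamma>. X \<gamma> - X ?\<gamma>) ` (?D - {?\<gamma>})"
  have span: "exchange_module n T \<l> = int_module.span (exchange_generators n T \<l>)"
  proof
    show "exchange_module n T \<l> \<subseteq> int_module.span (exchange_generators n T \<l>)"
      unfolding exchange_module_def
    proof (intro int_module.span_minimal subsetI)
      fix y assume "y \<in> {cluster_var n T \<l> \<alpha> - cluster_var n T \<l> \<beta> | \<alpha> \<beta>.
        \<alpha> \<in> ?D \<and> \<beta> \<in> ?D \<and> crosses \<alpha> \<beta>}"
      then show "y \<in> int_module.span (exchange_generators n T \<l>)"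
        using differences_in_span[OF assms(1), of _ _ X] unfolding gens X_def by blast
    qed (rule int_module.subspace_span)
    show "int_module.span (exchange_generators n T \<l>) \<subseteq> exchange_module n T \<l>"
      unfolding exchange_module_def exchange_generators_def by (rule int_module.span_mono) blast
  qed
  moreover have "int_module.span ?B = int_module.span (exchange_generators n T \<l>)"
  proof (rule int_module.span_eq[THEN iffD2], intro conjI subsetI)
    fix y assume "y \<in> ?B"
    then show "y \<in> int_module.span (exchange_generators n T \<l>)"
      using differences_in_span[OF assms(1), of _ _ X] \<gamma> unfolding gens by blast
  next
    fix y assume "y \<in> exchange_generators n T \<l>"
    then obtain \<alpha> \<beta> where y: "y = X \<alpha> - X \<beta>" and \<alpha>\<beta>: "\<alpha> \<in> ?D" "\<beta> \<in> ?D"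
      unfolding exchange_generators_def X_def by blast
    have base: "X \<delta> - X ?\<gamma> \<in> int_module.span ?B" if "\<delta> \<in> ?D" for \<delta>
      using that by (cases "\<delta> = ?\<gamma>") (auto intro: int_module.span_base int_module.span_zero)
    have "(X \<alpha> - X ?\<gamma>) - (X \<beta> - X ?\<gamma>) \<in> int_module.span ?B"
      by (rule int_module.span_diff[OF base[OF \<alpha>\<beta>(1)] base[OF \<alpha>\<beta>(2)]])
    then show "y \<in> int_module.span ?B" using y by simp
  qed
  moreover have "int_module.independent ?B"
    using finite_diagonals indep \<gamma> by (rule differences_to_base_independent)
  moreover have "inj_on (\<lambda>(\<alpha>, \<beta>). X \<alpha> - X \<beta>) (crossing_pairs_at_1 n)"
  proof (rule inj_onI, clarify)
    fix \<alpha> \<beta> \<alpha>' \<beta>'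
    assume P: "(\<alpha>, \<beta>) \<in> crossing_pairs_at_1 n" "(\<alpha>', \<beta>') \<in> crossing_pairs_at_1 n"
      and eq: "X \<alpha> - X \<beta> = X \<alpha>' - X \<beta>'"
    have D: "\<alpha> \<in> ?D" "\<beta> \<in> ?D" "\<alpha>' \<in> ?D" "\<beta>' \<in> ?D"
      using P by (auto simp: crossing_pairs_at_1_def)
    have one: "1 \<in> \<alpha>" "1 \<in> \<alpha>'" "1 \<notin> \<beta>" "1 \<notin> \<beta>'"
      using P by (auto simp: crossing_pairs_at_1_eq)
    \<comment> \<open>The coefficients of the relation given by two equal generators. Vertex 1
      separates first from second components, so vanishing at \<open>\<alpha>\<close> and at
      \<open>\<beta>\<close> forces the pairs to agree.\<close>
    define c :: "nat set \<Rightarrow> int" where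
      "c \<delta> = of_bool (\<delta> = \<alpha>) - of_bool (\<delta> = \<beta>) - of_bool (\<delta> = \<alpha>') + of_bool (\<delta> = \<beta>')" for \<delta>
    have pick: "(\<Sum>\<delta>\<in>?D. of_bool (\<delta> = \<epsilon>) * X \<delta>) = X \<epsilon>" if "\<epsilon> \<in> ?D" for \<epsilon>
      using that finite_diagonals by (simp add: of_bool_def if_distrib[of "\<lambda>x. x * _"] sum.delta cong: if_cong)
    have "(\<Sum>\<delta>\<in>?D. of_int (c \<delta>) * X \<delta>) = X \<alpha> - X \<beta> - X \<alpha>' + X \<beta>'"
      using D by (simp add: c_def distrib_right left_diff_distrib sum.distrib sum_subtractf pick)
    then have "(\<Sum>\<delta>\<in>?D. of_int (c \<delta>) * X \<delta>) = 0" using eq by simp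
    then have "\<forall>\<delta>\<in>?D. c \<delta> = 0" by (rule indep)
    then have "c \<alpha> = 0" "c \<beta> = 0" using D by blast+
    then show "\<alpha> = \<alpha>' \<and> \<beta> = \<beta>'"
      using one by (auto simp: c_def of_bool_def split: if_splits)
  qed
  then have "card (exchange_generators n T \<l>) = (n + 2) choose 3"
    unfolding gens by (simp add: card_image card_crossing_pairs_at_1)
  ultimately show ?thesis
    unfolding free_int_module_def by metis
qed

end
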